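(* Let $X$ be a quandle, let $0\to N\xrightarrow{i}G\xrightarrow{p}A\to 0$ be a short exact sequence of $\Lambda$-modules, and let $\phi\in Z^2_{\rm TQ}(X;A)$. For a set-theoretic section $s:A\to G$ ($ps=\mathrm{id}_A$) with $s(0)=0$, let $\theta=\theta_s:X\times X\times X\to N$ be the function determined by $$T s\phi(x_1,x_2)+s\phi(x_1*x_2,x_3)+T s\phi(x_2,x_3)=i\theta(x_1,x_2,x_3)+s\phi(x_2,x_3)+T s\phi(x_1,x_3)+s\phi(x_1*x_3,x_2*x_3).$$ Then the obstruction to extending the quandle $AE(X,A,\phi)=A\times X$ to $G\times X$ lies in $H^3_{\rm TQ}(X;N)$, in the following sense: $\theta_s$ is well defined and belongs to $Z^3_{\rm TQ}(X;N)$; its class $[\theta_s]\in H^3_{\rm TQ}(X;N)$ does not depend on the choice of the section $s$ with $s(0)=0$; and if $[\theta_s]=0$, then $G\times X$ admits a quandle structure such that $p\times\mathrm{id}_X:G\times X\to A\times X=AE(X,A,\phi)$ is a quandle homomorphism.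
   Context: A quandle is a set $X$ with a binary operation $*$ such that (I) $a*a=a$; (II) for all $a,b$ there is a unique $c$ with $a=c*b$; (III) $(a*b)*c=(a*c)*(b*c)$. A quandle homomorphism is a map preserving $*$. Let $\Lambda=\mathbb{Z}[T,T^{-1}]$. An Alexander quandle is a $\Lambda$-module $M$ with operation $a*b=Ta+(1-T)b$. For a quandle $X$, a $\Lambda$-module $A$ and $n\ge 1$, let $C^n_{\rm TQ}(X;A)$ be the $\Lambda$-module of functions $f:X^n\to A$ with $f(x_1,\dots,x_n)=0$ whenever $x_i=x_{i+1}$ for some $i\in\{1,\dots,n-1\}$, and define $\delta:C^n_{\rm TQ}(X;A)\to C^{n+1}_{\rm TQ}(X;A)$ by $$(\delta f)(x_1,\dots,x_{n+1})=(-1)^n\sum_{i=1}^{n+1}(-1)^i\big[T f(x_1,\dots,\widehat{x_i},\dots,x_{n+1})-f(x_1*x_i,\dots,x_{i-1}*x_i,x_{i+1},\dots,x_{n+1})\big].$$ $Z^n_{\rm TQ}(X;A)=\ker\delta$, $B^n_{\rm TQ}(X;A)=\operatorname{im}(\delta:C^{n-1}_{\rm TQ}\to C^n_{\rm TQ})$ (with $B^1_{\rm TQ}=0$), $H^n_{\rm TQ}=Z^n_{\rm TQ}/B^n_{\rm TQ}$. For $\phi\in Z^2_{\rm TQ}(X;A)$, the Alexander extension $AE(X,A,\phi)$ is the quandle on the set $A\times X$ with $(a_1,x_1)*(a_2,x_2)=(a_1*a_2+\phi(x_1,x_2),\,x_1*x_2)$. *)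

theory Defs
  imports Complex_Main "HOL-Library.Poly_Mapping"
begin

section \<open>Quandles\<close>

locale quandle =
  fixes X :: "'x set" and op :: "'x \<Rightarrow> 'x \<Rightarrow> 'x"  (infixl \<open>\<rhd>\<close> 70)
  assumes closed: "a \<in> X \<Longrightarrow> b \<in> X \<Longrightarrow> a \<rhd> b \<in> X"
    and idem: "a \<in> X \<Longrightarrow> a \<rhd> a = a"
    and right_division: "a \<in> X \<Longrightarrow> b \<in> X \<Longrightarrow> \<exists>!c. c \<in> X \<and> a = c \<rhd> b"
    and right_distrib:
      "a \<in> X \<Longrightarrow> b \<in> X \<Longrightarrow> c \<in> X \<Longrightarrow> (a \<rhd> b) \<rhd> c = (a \<rhd> c) \<rhd> (b \<rhd> c)"

locale quandle_hom = source: quandle X op1 + target: quandle Y op2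
  for X :: "'x set" and op1 :: "'x \<Rightarrow> 'x \<Rightarrow> 'x"
    and Y :: "'y set" and op2 :: "'y \<Rightarrow> 'y \<Rightarrow> 'y" +
  fixes h :: "'x \<Rightarrow> 'y"
  assumes maps_to: "a \<in> X \<Longrightarrow> h a \<in> Y"
    and hom: "a \<in> X \<Longrightarrow> b \<in> X \<Longrightarrow> h (op1 a b) = op2 (h a) (h b)"


section \<open>Modules over the Laurent polynomial ring\<close>

text \<open>
  The type \<open>int \<Rightarrow>\<^sub>0 int\<close> with its convolution product is the ring of Laurent
  polynomials with integer coefficients in one variable: the argument is the exponent and the
  value is the coefficient. A module over it is a scalar multiplication on a type of class
  \<^class>\<open>ab_group_add\<close> that satisfies \<^locale>\<open>module\<close>.
\<close>

type_synonym laurent = "int \<Rightarrow>\<^sub>0 int"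

definition T :: laurent where
  "T = Poly_Mapping.single 1 1"

lemma T_invertible:
  "T * Poly_Mapping.single (- 1) 1 = 1" "Poly_Mapping.single (- 1) 1 * T = 1"
  by (simp_all add: T_def mult_single)

definition alexander_op :: "(laurent \<Rightarrow> 'a \<Rightarrow> 'a) \<Rightarrow> 'a \<Rightarrow> 'a \<Rightarrow> 'a::ab_group_add" where
  "alexander_op scale a b = scale T a + scale (1 - T) b"

definition short_exact ::
  "(laurent \<Rightarrow> 'n \<Rightarrow> 'n::ab_group_add) \<Rightarrow> (laurent \<Rightarrow> 'g \<Rightarrow> 'g::ab_group_add)
    \<Rightarrow> (laurent \<Rightarrow> 'a \<Rightarrow> 'a::ab_group_add) \<Rightarrow> ('n \<Rightarrow> 'g) \<Rightarrow> ('g \<Rightarrow> 'a) \<Rightarrow> bool" where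
  "short_exact sN sG sA i p \<longleftrightarrow>
     module_hom sN sG i \<and> module_hom sG sA p \<and> inj i \<and> range i = {g. p g = 0} \<and> surj p"


section \<open>Twisted quandle cohomology\<close>

definition tuples :: "'x set \<Rightarrow> nat \<Rightarrow> 'x list set" where
  "tuples X n = {xs. length xs = n \<and> set xs \<subseteq> X}"

text \<open>
  Functions on \<open>n\<close>-tuples are total functions on lists that are set to \<open>0\<close> outside
  \<open>tuples X n\<close>, so that equality of such functions is equality on tuples. List positions
  count from \<open>0\<close>.
\<close>

definition tuple_functions :: "'x set \<Rightarrow> nat \<Rightarrow> ('x list \<Rightarrow> 'a::zero) set" where
  "tuple_functions X n = {f. \<forall>xs. xs \<notin> tuples X n \<longrightarrow> f xs = 0}"

definition TQ_cochains :: "'x set \<Rightarrow> nat \<Rightarrow> ('x list \<Rightarrow> 'a::zero) set" where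
  "TQ_cochains X n =
     {f \<in> tuple_functions X n.
        \<forall>xs \<in> tuples X n. (\<exists>i. Suc i < n \<and> xs ! i = xs ! Suc i) \<longrightarrow> f xs = 0}"

definition TQ_delta ::
  "'x set \<Rightarrow> ('x \<Rightarrow> 'x \<Rightarrow> 'x) \<Rightarrow> (laurent \<Rightarrow> 'a \<Rightarrow> 'a) \<Rightarrow> nat
    \<Rightarrow> ('x list \<Rightarrow> 'a) \<Rightarrow> 'x list \<Rightarrow> 'a::ab_group_add" where
  "TQ_delta X op scale n f xs =
     (if xs \<in> tuples X (n + 1) then
        scale ((- 1) ^ n)
          (\<Sum>i = 1..n + 1. scale ((- 1) ^ i)
             (scale T (f (take (i - 1) xs @ drop i xs))
              - f (map (\<lambda>x. op x (xs ! (i - 1))) (take (i - 1) xs) @ drop i xs)))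
      else 0)"

definition TQ_cocycles ::
  "'x set \<Rightarrow> ('x \<Rightarrow> 'x \<Rightarrow> 'x) \<Rightarrow> (laurent \<Rightarrow> 'a \<Rightarrow> 'a::ab_group_add) \<Rightarrow> nat
    \<Rightarrow> ('x list \<Rightarrow> 'a) set" where
  "TQ_cocycles X op scale n = {f \<in> TQ_cochains X n. TQ_delta X op scale n f = (\<lambda>_. 0)}"

text \<open>The cochain groups start in degree one, whence the separate clause for \<open>n \<le> 1\<close>.\<close>

definition TQ_coboundaries ::
  "'x set \<Rightarrow> ('x \<Rightarrow> 'x \<Rightarrow> 'x) \<Rightarrow> (laurent \<Rightarrow> 'a \<Rightarrow> 'a::ab_group_add) \<Rightarrow> nat
    \<Rightarrow> ('x list \<Rightarrow> 'a) set" where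
  "TQ_coboundaries X op scale n =
     (if n \<le> 1 then {\<lambda>_. 0} else TQ_delta X op scale (n - 1) ` TQ_cochains X (n - 1))"

definition TQ_cohomologous ::
  "'x set \<Rightarrow> ('x \<Rightarrow> 'x \<Rightarrow> 'x) \<Rightarrow> (laurent \<Rightarrow> 'a \<Rightarrow> 'a::ab_group_add) \<Rightarrow> nat
    \<Rightarrow> (('x list \<Rightarrow> 'a) \<times> ('x list \<Rightarrow> 'a)) set" where
  "TQ_cohomologous X op scale n =
     {(f, g). f \<in> TQ_cocycles X op scale n \<and> g \<in> TQ_cocycles X op scale n
        \<and> (\<lambda>xs. f xs - g xs) \<in> TQ_coboundaries X op scale n}"

definition TQ_cohomology ::
  "'x set \<Rightarrow> ('x \<Rightarrow> 'x \<Rightarrow> 'x) \<Rightarrow> (laurent \<Rightarrow> 'a \<Rightarrow> 'a::ab_group_add) \<Rightarrow> nat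
    \<Rightarrow> ('x list \<Rightarrow> 'a) set set" where
  "TQ_cohomology X op scale n = TQ_cocycles X op scale n // TQ_cohomologous X op scale n"

definition TQ_class ::
  "'x set \<Rightarrow> ('x \<Rightarrow> 'x \<Rightarrow> 'x) \<Rightarrow> (laurent \<Rightarrow> 'a \<Rightarrow> 'a::ab_group_add) \<Rightarrow> nat
    \<Rightarrow> ('x list \<Rightarrow> 'a) \<Rightarrow> ('x list \<Rightarrow> 'a) set" where
  "TQ_class X op scale n f = TQ_cohomologous X op scale n `` {f}"

definition TQ_zero_class ::
  "'x set \<Rightarrow> ('x \<Rightarrow> 'x \<Rightarrow> 'x) \<Rightarrow> (laurent \<Rightarrow> 'a \<Rightarrow> 'a::ab_group_add) \<Rightarrow> nat
    \<Rightarrow> ('x list \<Rightarrow> 'a) set" where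
  "TQ_zero_class X op scale n = TQ_class X op scale n (\<lambda>_. 0)"


section \<open>Alexander extensions and the obstruction cochain\<close>

definition AE_op ::
  "('x \<Rightarrow> 'x \<Rightarrow> 'x) \<Rightarrow> (laurent \<Rightarrow> 'a \<Rightarrow> 'a::ab_group_add) \<Rightarrow> ('x list \<Rightarrow> 'a)
    \<Rightarrow> 'a \<times> 'x \<Rightarrow> 'a \<times> 'x \<Rightarrow> 'a \<times> 'x" where
  "AE_op op scale \<phi> u v =
     (alexander_op scale (fst u) (fst v) + \<phi> [snd u, snd v], op (snd u) (snd v))"

definition normalized_section :: "('g::zero \<Rightarrow> 'a::zero) \<Rightarrow> ('a \<Rightarrow> 'g) \<Rightarrow> bool" where
  "normalized_section p s \<longleftrightarrow> (\<forall>a. p (s a) = a) \<and> s 0 = 0"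

definition is_obstruction_cochain ::
  "'x set \<Rightarrow> ('x \<Rightarrow> 'x \<Rightarrow> 'x) \<Rightarrow> (laurent \<Rightarrow> 'g \<Rightarrow> 'g::ab_group_add)
    \<Rightarrow> ('n::zero \<Rightarrow> 'g) \<Rightarrow> ('x list \<Rightarrow> 'a) \<Rightarrow> ('a \<Rightarrow> 'g) \<Rightarrow> ('x list \<Rightarrow> 'n) \<Rightarrow> bool" where
  "is_obstruction_cochain X op sG i \<phi> s \<theta> \<longleftrightarrow>
     \<theta> \<in> tuple_functions X 3 \<and>
     (\<forall>x1 \<in> X. \<forall>x2 \<in> X. \<forall>x3 \<in> X.
        sG T (s (\<phi> [x1, x2])) + s (\<phi> [op x1 x2, x3]) + sG T (s (\<phi> [x2, x3]))
        = i (\<theta> [x1, x2, x3]) + s (\<phi> [x2, x3]) + sG T (s (\<phi> [x1, x3]))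
          + s (\<phi> [op x1 x3, op x2 x3]))"

definition obstruction_cochain ::
  "'x set \<Rightarrow> ('x \<Rightarrow> 'x \<Rightarrow> 'x) \<Rightarrow> (laurent \<Rightarrow> 'g \<Rightarrow> 'g::ab_group_add)
    \<Rightarrow> ('n::zero \<Rightarrow> 'g) \<Rightarrow> ('x list \<Rightarrow> 'a) \<Rightarrow> ('a \<Rightarrow> 'g) \<Rightarrow> 'x list \<Rightarrow> 'n" where
  "obstruction_cochain X op sG i \<phi> s = (THE \<theta>. is_obstruction_cochain X op sG i \<phi> s \<theta>)"

end

theory Submission
  imports Defs
begin

text \<open>
  In terms of the \<open>G\<close>-valued cochain \<open>s \<circ> \<phi>\<close>, the equation that determines \<open>\<theta>\<close> says exactly
  that \<open>i \<circ> \<theta> = - \<delta> (s \<circ> \<phi>)\<close> (\<open>obstruction_iff\<close>). So \<open>\<theta>\<close> is the value on \<open>\<phi>\<close> of the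
  connecting map of the short exact sequence, up to sign, and the proof is the usual diagram
  chase. The section \<open>s\<close> is not additive, but \<open>\<delta>\<close> only needs the additive structure of the
  values of \<open>s \<circ> \<phi>\<close>; the condition \<open>s 0 = 0\<close> makes \<open>s \<circ> \<phi>\<close> vanish on degenerate pairs.

  The map \<open>\<delta>\<close> commutes with composition by module homomorphisms (\<open>TQ_delta_hom\<close>). Hence
  \<open>p \<circ> \<delta> (s \<circ> \<phi>) = \<delta> \<phi> = 0\<close>, so \<open>\<theta>\<close> exists by exactness, and it is a cocycle because \<open>i\<close> is
  injective and \<open>\<delta> \<circ> \<delta> = 0\<close> (\<open>TQ_delta_delta\<close>). For two sections, \<open>s \<circ> \<phi> - t \<circ> \<phi>\<close> has values in
  the kernel of \<open>p\<close>, so it equals \<open>i \<circ> \<eta>\<close> for a cochain \<open>\<eta>\<close>, and \<open>\<theta>\<^sub>s - \<theta>\<^sub>t = - \<delta> \<eta>\<close>. Finally,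
  if \<open>\<theta> = \<delta> \<eta>\<close>, then \<open>\<psi> = s \<circ> \<phi> + i \<circ> \<eta>\<close> is a \<open>G\<close>-valued cocycle with \<open>p \<circ> \<psi> = \<phi>\<close>, and the
  Alexander extension of \<open>X\<close> by \<open>\<psi>\<close> is the required quandle on \<open>G \<times> X\<close>
  (\<open>quandle_AE\<close>, \<open>quandle_hom_AE\<close>).
\<close>


section \<open>The coboundary map\<close>

lemma tuples_2_iff: "xs \<in> tuples X 2 \<longleftrightarrow> (\<exists>x\<in>X. \<exists>y\<in>X. xs = [x, y])"
  by (auto simp: tuples_def eval_nat_numeral length_Suc_conv)

lemma tuples_3_iff: "xs \<in> tuples X 3 \<longleftrightarrow> (\<exists>x\<in>X. \<exists>y\<in>X. \<exists>z\<in>X. xs = [x, y, z])"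
  by (auto simp: tuples_def eval_nat_numeral length_Suc_conv)

lemma tuples_4_iff:
  "xs \<in> tuples X 4 \<longleftrightarrow> (\<exists>x\<in>X. \<exists>y\<in>X. \<exists>z\<in>X. \<exists>w\<in>X. xs = [x, y, z, w])"
  by (auto simp: tuples_def eval_nat_numeral length_Suc_conv)

lemma TQ_delta_outside: "xs \<notin> tuples X (n + 1) \<Longrightarrow> TQ_delta X op scale n f xs = 0"
  by (simp add: TQ_delta_def)

lemma TQ_delta_diff:
  assumes "module scale"
  shows "TQ_delta X op scale n (\<lambda>xs. f xs - g xs)
    = (\<lambda>xs. TQ_delta X op scale n f xs - TQ_delta X op scale n g xs)"
proof -
  interpret module scale by fact
  show ?thesis
    by (rule ext)
      (simp add: TQ_delta_def sum_subtractf sum.distrib algebra_simps)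
qed

lemma TQ_delta_zero:
  assumes "module scale"
  shows "TQ_delta X op scale n (\<lambda>xs. 0) = (\<lambda>xs. 0)"
  using TQ_delta_diff[OF assms, of X op n "\<lambda>xs. 0" "\<lambda>xs. 0"] by simp

lemma TQ_delta_uminus:
  assumes "module scale"
  shows "TQ_delta X op scale n (\<lambda>xs. - f xs) = (\<lambda>xs. - TQ_delta X op scale n f xs)"
  using TQ_delta_diff[OF assms, of X op n "\<lambda>xs. 0" f]
  by (simp add: TQ_delta_zero assms)

lemma TQ_delta_add:
  assumes "module scale"
  shows "TQ_delta X op scale n (\<lambda>xs. f xs + g xs)
    = (\<lambda>xs. TQ_delta X op scale n f xs + TQ_delta X op scale n g xs)"
  using TQ_delta_diff[OF assms, of X op n f "\<lambda>xs. - g xs"] TQ_delta_uminus[OF assms, of X op n g]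
  by simp

lemma TQ_delta_hom:
  assumes "module_hom s1 s2 h"
  shows "TQ_delta X op s2 n (\<lambda>xs. h (f xs)) = (\<lambda>xs. h (TQ_delta X op s1 n f xs))"
proof -
  interpret module_hom s1 s2 h by fact
  show ?thesis
    by (rule ext) (simp add: TQ_delta_def scale diff sum)
qed

lemma TQ_delta_2:
  assumes "module scale" "x \<in> X" "y \<in> X" "z \<in> X"
  shows "TQ_delta X op scale 2 f [x, y, z]
    = f [y, z] - scale T (f [y, z]) + scale T (f [x, z]) - f [op x y, z]
      - scale T (f [x, y]) + f [op x z, op y z]"
proof -
  interpret module scale by fact
  have [simp]: "{Suc 0..3} = {1, 2, 3}" by auto
  show ?thesis
    using assms(2-4) by (simp add: TQ_delta_def tuples_def)
qed

lemma TQ_delta_3: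
  assumes "module scale" "x \<in> X" "y \<in> X" "z \<in> X" "w \<in> X"
  shows "TQ_delta X op scale 3 f [x, y, z, w]
    = scale T (f [y, z, w]) - f [y, z, w]
      - scale T (f [x, z, w]) + f [op x y, z, w]
      + scale T (f [x, y, w]) - f [op x z, op y z, w]
      - scale T (f [x, y, z]) + f [op x w, op y w, op z w]"
proof -
  interpret module scale by fact
  have [simp]: "{Suc 0..4} = {1, 2, 3, 4}" by auto
  show ?thesis
    using assms(2-5) by (simp add: TQ_delta_def tuples_def eval_nat_numeral scale_right_diff_distrib)
qed

text \<open>
  Only the composite from degree two to degree four is needed. It vanishes on arbitrary functions
  of pairs, degenerate or not: the terms cancel by right distributivity alone.
\<close>

lemma TQ_delta_delta:
  assumes "quandle X op" "module scale"
  shows "TQ_delta X op scale 3 (TQ_delta X op scale 2 f) = (\<lambda>xs. 0)"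
proof
  interpret quandle X op by fact
  interpret module scale by fact
  fix xs
  show "TQ_delta X op scale 3 (TQ_delta X op scale 2 f) xs = 0"
  proof (cases "xs \<in> tuples X 4")
    case True
    then obtain x y z w where "xs = [x, y, z, w]" and X: "x \<in> X" "y \<in> X" "z \<in> X" "w \<in> X"
      unfolding tuples_4_iff by blast
    moreover have "op (op x y) z = op (op x z) (op y z)" "op (op x y) w = op (op x w) (op y w)"
      "op (op x z) w = op (op x w) (op z w)" "op (op y z) w = op (op y w) (op z w)"
      using X by (simp_all add: right_distrib)
    ultimately show ?thesis
      by (simp add: TQ_delta_2 TQ_delta_3 assms(2) closed scale_right_diff_distrib
          scale_right_distrib)
  qed (simp add: TQ_delta_outside)
qed


section \<open>Cochains and cohomology classes\<close>

lemma TQ_cochains_2_iff: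
  "f \<in> TQ_cochains X 2 \<longleftrightarrow> (\<forall>xs. xs \<notin> tuples X 2 \<longrightarrow> f xs = 0) \<and> (\<forall>x\<in>X. f [x, x] = 0)"
  by (auto simp: TQ_cochains_def tuple_functions_def tuples_2_iff)

lemma TQ_cochains_3_iff:
  "f \<in> TQ_cochains X 3 \<longleftrightarrow> (\<forall>xs. xs \<notin> tuples X 3 \<longrightarrow> f xs = 0)
    \<and> (\<forall>x\<in>X. \<forall>y\<in>X. \<forall>z\<in>X. x = y \<or> y = z \<longrightarrow> f [x, y, z] = 0)"
proof -
  have "(\<exists>i. Suc i < 3 \<and> xs ! i = xs ! Suc i) \<longleftrightarrow> xs ! 0 = xs ! 1 \<or> xs ! 1 = xs ! 2"
    for xs :: "'a list"
    by (auto simp: eval_nat_numeral less_Suc_eq)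
  moreover have "(\<forall>xs\<in>tuples X 3. P xs) \<longleftrightarrow> (\<forall>x\<in>X. \<forall>y\<in>X. \<forall>z\<in>X. P [x, y, z])" for P
    unfolding tuples_3_iff Ball_def by blast
  ultimately show ?thesis
    by (simp add: TQ_cochains_def tuple_functions_def)
qed

lemma TQ_cochains_diff:
  fixes f g :: "'x list \<Rightarrow> 'a::ab_group_add"
  shows "f \<in> TQ_cochains X n \<Longrightarrow> g \<in> TQ_cochains X n \<Longrightarrow> (\<lambda>xs. f xs - g xs) \<in> TQ_cochains X n"
  by (auto simp: TQ_cochains_def tuple_functions_def)

lemma TQ_cochains_zero: "(\<lambda>xs. 0) \<in> TQ_cochains X n"
  by (simp add: TQ_cochains_def tuple_functions_def)

lemma TQ_cochains_comp:
  assumes "f \<in> TQ_cochains X n" "h 0 = 0"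
  shows "(\<lambda>xs. h (f xs)) \<in> TQ_cochains X n"
  using assms by (auto simp: TQ_cochains_def tuple_functions_def)

lemma TQ_cochains_comp_cancel:
  assumes "(\<lambda>xs. h (f xs)) \<in> TQ_cochains X n" "inj h" "h 0 = 0"
  shows "f \<in> TQ_cochains X n"
proof -
  have "h a = 0 \<longleftrightarrow> a = 0" for a
    using assms(2,3) by (metis injD)
  then show ?thesis
    using assms(1) by (simp add: TQ_cochains_def tuple_functions_def)
qed

lemma TQ_delta_2_cochain:
  assumes "quandle X op" "module scale" "f \<in> TQ_cochains X 2"
  shows "TQ_delta X op scale 2 f \<in> TQ_cochains X 3"
proof -
  interpret quandle X op by fact
  interpret module scale by fact
  have 0: "f [x, x] = 0" if "x \<in> X" for x
    using assms(3) that by (simp add: TQ_cochains_2_iff)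
  have "TQ_delta X op scale 2 f [x, y, z] = 0"
    if "x \<in> X" "y \<in> X" "z \<in> X" "x = y \<or> y = z" for x y z
    using that by (auto simp: TQ_delta_2 assms(2) 0 closed idem)
  then show ?thesis
    by (simp add: TQ_cochains_3_iff TQ_delta_outside)
qed

lemma TQ_cocycles_zero:
  assumes "module scale"
  shows "(\<lambda>xs. 0) \<in> TQ_cocycles X op scale n"
  by (simp add: TQ_cocycles_def TQ_cochains_zero TQ_delta_zero assms)

lemma TQ_coboundaries_diff:
  assumes "module scale"
    and "f \<in> TQ_coboundaries X op scale n" "g \<in> TQ_coboundaries X op scale n"
  shows "(\<lambda>xs. f xs - g xs) \<in> TQ_coboundaries X op scale n"
proof (cases "n \<le> 1")
  case False
  then obtain a b where "a \<in> TQ_cochains X (n - 1)" "b \<in> TQ_cochains X (n - 1)"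
    and "f = TQ_delta X op scale (n - 1) a" "g = TQ_delta X op scale (n - 1) b"
    using assms(2,3) by (auto simp: TQ_coboundaries_def)
  then have "(\<lambda>xs. f xs - g xs) = TQ_delta X op scale (n - 1) (\<lambda>xs. a xs - b xs)"
    and "(\<lambda>xs. a xs - b xs) \<in> TQ_cochains X (n - 1)"
    by (simp_all add: TQ_delta_diff assms(1) TQ_cochains_diff)
  with False show ?thesis
    by (auto simp: TQ_coboundaries_def)
qed (use assms in \<open>simp add: TQ_coboundaries_def\<close>)

lemma TQ_coboundaries_zero:
  assumes "module scale"
  shows "(\<lambda>xs. 0) \<in> TQ_coboundaries X op scale n"
proof (cases "n \<le> 1")
  case False
  have "(\<lambda>xs. 0) = TQ_delta X op scale (n - 1) (\<lambda>xs. 0)"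
    by (simp add: TQ_delta_zero assms)
  with False show ?thesis
    using TQ_cochains_zero[of X "n - 1"] by (auto simp: TQ_coboundaries_def)
qed (simp add: TQ_coboundaries_def)

lemma equiv_TQ_cohomologous:
  assumes "module scale"
  shows "equiv (TQ_cocycles X op scale n) (TQ_cohomologous X op scale n)"
proof (rule equivI)
  show "TQ_cohomologous X op scale n \<subseteq> TQ_cocycles X op scale n \<times> TQ_cocycles X op scale n"
    by (auto simp: TQ_cohomologous_def)
  show "refl_on (TQ_cocycles X op scale n) (TQ_cohomologous X op scale n)"
    by (auto simp: refl_on_def TQ_cohomologous_def TQ_coboundaries_zero assms)
  have minus: "(\<lambda>xs. - f xs) \<in> TQ_coboundaries X op scale n"
    if "f \<in> TQ_coboundaries X op scale n" for f
    using TQ_coboundaries_diff[OF assms TQ_coboundaries_zero[OF assms] that] by simp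
  show "sym (TQ_cohomologous X op scale n)"
  proof (rule symI)
    fix f g assume "(f, g) \<in> TQ_cohomologous X op scale n"
    then show "(g, f) \<in> TQ_cohomologous X op scale n"
      using minus[of "\<lambda>xs. f xs - g xs"] by (simp add: TQ_cohomologous_def)
  qed
  show "trans (TQ_cohomologous X op scale n)"
  proof (rule transI)
    fix f g h
    assume "(f, g) \<in> TQ_cohomologous X op scale n" "(g, h) \<in> TQ_cohomologous X op scale n"
    then show "(f, h) \<in> TQ_cohomologous X op scale n"
      using TQ_coboundaries_diff[OF assms, of "\<lambda>xs. f xs - g xs" X op n "\<lambda>xs. - (g xs - h xs)"]
        minus[of "\<lambda>xs. g xs - h xs"]
      by (simp add: TQ_cohomologous_def)
  qed
qed

lemma TQ_class_eq_iff:
  assumes "module scale" "f \<in> TQ_cocycles X op scale n" "g \<in> TQ_cocycles X op scale n"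
  shows "TQ_class X op scale n f = TQ_class X op scale n g
    \<longleftrightarrow> (\<lambda>xs. f xs - g xs) \<in> TQ_coboundaries X op scale n"
  using eq_equiv_class_iff[OF equiv_TQ_cohomologous[OF assms(1)] assms(2,3)] assms(2,3)
  by (simp add: TQ_class_def TQ_cohomologous_def)

lemma TQ_class_in_cohomology:
  "f \<in> TQ_cocycles X op scale n \<Longrightarrow> TQ_class X op scale n f \<in> TQ_cohomology X op scale n"
  by (simp add: TQ_class_def TQ_cohomology_def quotientI)


section \<open>Alexander extensions\<close>

text \<open>
  Idempotence of the extension is the vanishing of \<open>\<psi>\<close> on degenerate pairs, right division comes
  from the invertibility of \<open>T\<close>, and right distributivity is the cocycle equation.
\<close>

lemma quandle_AE:
  fixes scale :: "laurent \<Rightarrow> 'a \<Rightarrow> 'a::ab_group_add"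
  assumes "quandle X op" "module scale" "\<psi> \<in> TQ_cocycles X op scale 2"
  shows "quandle (UNIV \<times> X) (AE_op op scale \<psi>)"
proof -
  interpret quandle X op by fact
  interpret module scale by fact
  have cocycle: "TQ_delta X op scale 2 \<psi> = (\<lambda>xs. 0)" and cochain: "\<psi> \<in> TQ_cochains X 2"
    using assms(3) by (auto simp: TQ_cocycles_def)
  \<comment> \<open>Multiplication by \<open>T\<close> is bijective, which gives right division in the module component.\<close>
  have solve: "scale T c = a \<longleftrightarrow> c = scale (Poly_Mapping.single (- 1) 1) a" for a c
    by (metis T_invertible scale_scale scale_one)
  show ?thesis
  proof
    fix u v :: "'a \<times> 'b" assume u: "u \<in> UNIV \<times> X" and v: "v \<in> UNIV \<times> X"
    show "AE_op op scale \<psi> u v \<in> UNIV \<times> X"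
      using u v by (auto simp: AE_op_def closed)
    obtain a x b y where uv: "u = (a, x)" "v = (b, y)" and xy: "x \<in> X" "y \<in> X"
      using u v by auto
    obtain z where z: "z \<in> X" "x = op z y" and z_unique: "\<And>z'. z' \<in> X \<Longrightarrow> x = op z' y \<Longrightarrow> z' = z"
      using right_division[OF xy] by blast
    let ?c = "scale (Poly_Mapping.single (- 1) 1) (a - scale (1 - T) b - \<psi> [z, y])"
    have a: "a = scale T c + scale (1 - T) b + \<psi> [z, y] \<longleftrightarrow> c = ?c" for c
      unfolding solve[symmetric] by (auto simp: algebra_simps)
    show "\<exists>!w. w \<in> UNIV \<times> X \<and> u = AE_op op scale \<psi> w v"
    proof (rule ex1I[of _ "(?c, z)"])
      show "(?c, z) \<in> UNIV \<times> X \<and> u = AE_op op scale \<psi> (?c, z) v"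
        using z a[of ?c] by (simp add: uv AE_op_def alexander_op_def)
    next
      fix w assume w: "w \<in> UNIV \<times> X \<and> u = AE_op op scale \<psi> w v"
      then have "snd w = z"
        by (intro z_unique) (auto simp: uv AE_op_def)
      with w a[of "fst w"] show "w = (?c, z)"
        by (cases w) (auto simp: uv AE_op_def alexander_op_def)
    qed
  next
    fix u :: "'a \<times> 'b" assume "u \<in> UNIV \<times> X"
    with cochain show "AE_op op scale \<psi> u u = u"
      by (auto simp: AE_op_def alexander_op_def idem TQ_cochains_2_iff scale_left_diff_distrib)
  next
    fix u v w :: "'a \<times> 'b"
    assume "u \<in> UNIV \<times> X" "v \<in> UNIV \<times> X" "w \<in> UNIV \<times> X"
    then obtain a x b y c z where uvw: "u = (a, x)" "v = (b, y)" "w = (c, z)"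
      and xyz: "x \<in> X" "y \<in> X" "z \<in> X"
      by auto
    have "\<psi> [op x y, z] = \<psi> [y, z] - scale T (\<psi> [y, z]) + scale T (\<psi> [x, z])
        - scale T (\<psi> [x, y]) + \<psi> [op x z, op y z]"
      using TQ_delta_2[OF assms(2) xyz, of op \<psi>] by (simp add: cocycle algebra_simps)
    with xyz show "AE_op op scale \<psi> (AE_op op scale \<psi> u v) w
      = AE_op op scale \<psi> (AE_op op scale \<psi> u w) (AE_op op scale \<psi> v w)"
      by (simp add: uvw AE_op_def alexander_op_def right_distrib scale_left_diff_distrib
          scale_right_distrib scale_right_diff_distrib left_diff_distrib)
  qed
qed

lemma quandle_hom_AE:
  assumes "quandle X op" "module_hom sG sA p"
    and "\<psi> \<in> TQ_cocycles X op sG 2" "\<phi> \<in> TQ_cocycles X op sA 2" "\<And>xs. p (\<psi> xs) = \<phi> xs"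
  shows "quandle_hom (UNIV \<times> X) (AE_op op sG \<psi>) (UNIV \<times> X) (AE_op op sA \<phi>) (map_prod p id)"
proof -
  interpret p: module_hom sG sA p by fact
  interpret source: quandle "UNIV \<times> X" "AE_op op sG \<psi>"
    by (rule quandle_AE[OF assms(1) p.m1.module_axioms assms(3)])
  interpret target: quandle "UNIV \<times> X" "AE_op op sA \<phi>"
    by (rule quandle_AE[OF assms(1) p.m2.module_axioms assms(4)])
  show ?thesis
    by unfold_locales
      (auto simp: AE_op_def alexander_op_def p.add p.scale assms(5))
qed


section \<open>The obstruction cocycle\<close>

text \<open>
  The left-hand side of the defining equation minus the terms of the right-hand side other than
  \<open>i \<theta>\<close> is \<open>- \<delta> (s \<circ> \<phi>)\<close>.
\<close>

lemma obstruction_iff: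
  assumes "module_hom sN sG i"
  shows "is_obstruction_cochain X op sG i \<phi> s \<theta> \<longleftrightarrow> \<theta> \<in> tuple_functions X 3
    \<and> (\<forall>xs. i (\<theta> xs) = - TQ_delta X op sG 2 (\<lambda>xs. s (\<phi> xs)) xs)"
    (is "?L \<longleftrightarrow> ?f \<and> (\<forall>xs. ?e xs)")
proof -
  interpret i: module_hom sN sG i by fact
  have "?e xs" if "?f" "xs \<notin> tuples X 3" for xs
    using that by (simp add: tuple_functions_def TQ_delta_outside i.zero)
  then have "(\<forall>xs. ?e xs) \<longleftrightarrow> (\<forall>xs\<in>tuples X 3. ?e xs)" if "?f"
    using that by blast
  also have "(\<forall>xs\<in>tuples X 3. ?e xs)
      \<longleftrightarrow> (\<forall>x1\<in>X. \<forall>x2\<in>X. \<forall>x3\<in>X. ?e [x1, x2, x3])"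
    by (auto simp: tuples_3_iff)
  also have "\<dots> \<longleftrightarrow> (\<forall>x1\<in>X. \<forall>x2\<in>X. \<forall>x3\<in>X.
        sG T (s (\<phi> [x1, x2])) + s (\<phi> [op x1 x2, x3]) + sG T (s (\<phi> [x2, x3]))
        = i (\<theta> [x1, x2, x3]) + s (\<phi> [x2, x3]) + sG T (s (\<phi> [x1, x3]))
          + s (\<phi> [op x1 x3, op x2 x3]))"
    by (intro ball_cong refl)
      (auto simp: TQ_delta_2[OF i.m2.module_axioms] algebra_simps)
  finally show ?thesis
    unfolding is_obstruction_cochain_def by blast
qed

text \<open>The data of the extension problem, fixed for the diagram chase.\<close>

locale obstruction =
  fixes X :: "'x set" and op :: "'x \<Rightarrow> 'x \<Rightarrow> 'x"
    and sN :: "laurent \<Rightarrow> 'n \<Rightarrow> 'n::ab_group_add"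
    and sG :: "laurent \<Rightarrow> 'g \<Rightarrow> 'g::ab_group_add"
    and sA :: "laurent \<Rightarrow> 'a \<Rightarrow> 'a::ab_group_add"
    and i :: "'n \<Rightarrow> 'g" and p :: "'g \<Rightarrow> 'a" and \<phi> :: "'x list \<Rightarrow> 'a"
  assumes quandle: "quandle X op"
    and exact: "short_exact sN sG sA i p"
    and cocycle: "\<phi> \<in> TQ_cocycles X op sA 2"
begin

sublocale i: module_hom sN sG i
  using exact by (simp add: short_exact_def)

sublocale p: module_hom sG sA p
  using exact by (simp add: short_exact_def)

lemmas mod_N = i.m1.module_axioms
lemmas mod_G = i.m2.module_axioms

lemma inj: "inj i"
  using exact by (simp add: short_exact_def)

lemma i_eq_iff [simp]: "i a = i b \<longleftrightarrow> a = b"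
  using inj by (rule inj_eq)

lemma i_eq_0_iff [simp]: "i a = 0 \<longleftrightarrow> a = 0"
  using i_eq_iff[of a 0] by (simp del: i_eq_iff)

lemma p_i [simp]: "p (i a) = 0"
  using exact by (auto simp: short_exact_def)

lemma lift_to_N:
  assumes "\<And>xs. p (f xs) = 0"
  shows "\<exists>h. \<forall>xs. i (h xs) = f xs"
proof -
  have "f xs \<in> range i" for xs
    using exact assms by (simp add: short_exact_def)
  then have "i (inv i (f xs)) = f xs" for xs
    by (rule f_inv_into_f)
  then show ?thesis by (intro exI[of _ "\<lambda>xs. inv i (f xs)"]) blast
qed

lemma section_cochain:
  assumes "normalized_section p s"
  shows "(\<lambda>xs. s (\<phi> xs)) \<in> TQ_cochains X 2"
  using assms cocycle by (simp add: TQ_cochains_comp normalized_section_def TQ_cocycles_def)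

lemma ex1_obstruction:
  assumes "normalized_section p s"
  shows "\<exists>!\<theta>. is_obstruction_cochain X op sG i \<phi> s \<theta>"
proof -
  let ?d = "TQ_delta X op sG 2 (\<lambda>xs. s (\<phi> xs))"
  have "p (?d xs) = TQ_delta X op sA 2 (\<lambda>xs. p (s (\<phi> xs))) xs" for xs
    by (simp add: TQ_delta_hom[OF p.module_hom_axioms])
  also have "\<dots> xs = 0" for xs
    using assms cocycle by (simp add: normalized_section_def TQ_cocycles_def)
  finally have "p (- ?d xs) = 0" for xs
    by (simp add: p.neg)
  then obtain \<theta> where \<theta>: "\<And>xs. i (\<theta> xs) = - ?d xs"
    using lift_to_N[of "\<lambda>xs. - ?d xs"] by blast
  have "\<theta> xs = 0" if "xs \<notin> tuples X 3" for xs
    using \<theta>[of xs] that by (simp add: TQ_delta_outside)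
  then have "\<theta> \<in> tuple_functions X 3"
    by (simp add: tuple_functions_def)
  with \<theta> have "is_obstruction_cochain X op sG i \<phi> s \<theta>"
    by (simp add: obstruction_iff[OF i.module_hom_axioms])
  moreover have "\<theta>' = \<theta>" if "is_obstruction_cochain X op sG i \<phi> s \<theta>'" for \<theta>'
  proof
    fix xs
    show "\<theta>' xs = \<theta> xs"
      using that \<theta>[of xs] i_eq_iff[of "\<theta>' xs" "\<theta> xs"]
      by (simp add: obstruction_iff[OF i.module_hom_axioms] del: i_eq_iff)
  qed
  ultimately show ?thesis by blast
qed

lemma i_obstruction:
  assumes "normalized_section p s"
  shows "i (obstruction_cochain X op sG i \<phi> s xs) = - TQ_delta X op sG 2 (\<lambda>xs. s (\<phi> xs)) xs"
proof -
  have "is_obstruction_cochain X op sG i \<phi> s (obstruction_cochain X op sG i \<phi> s)"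
    unfolding obstruction_cochain_def by (rule theI'[OF ex1_obstruction[OF assms]])
  then show ?thesis
    by (simp add: obstruction_iff[OF i.module_hom_axioms])
qed

lemma obstruction_cocycle:
  assumes "normalized_section p s"
  shows "obstruction_cochain X op sG i \<phi> s \<in> TQ_cocycles X op sN 3"
proof -
  let ?\<theta> = "obstruction_cochain X op sG i \<phi> s"
  let ?d = "TQ_delta X op sG 2 (\<lambda>xs. s (\<phi> xs))"
  have i\<theta>: "(\<lambda>xs. i (?\<theta> xs)) = (\<lambda>xs. - ?d xs)"
    by (simp add: i_obstruction[OF assms])
  have "?d \<in> TQ_cochains X 3"
    by (rule TQ_delta_2_cochain[OF quandle mod_G section_cochain[OF assms]])
  then have "(\<lambda>xs. i (?\<theta> xs)) \<in> TQ_cochains X 3"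
    unfolding i\<theta> by (rule TQ_cochains_comp) simp
  then have cochain: "?\<theta> \<in> TQ_cochains X 3"
    by (rule TQ_cochains_comp_cancel[OF _ inj i.zero])
  have "(\<lambda>xs. i (TQ_delta X op sN 3 ?\<theta> xs)) = (\<lambda>xs. 0)"
    unfolding TQ_delta_hom[OF i.module_hom_axioms, symmetric] i\<theta>
    by (simp add: TQ_delta_uminus[OF mod_G] TQ_delta_delta[OF quandle mod_G])
  then have "TQ_delta X op sN 3 ?\<theta> = (\<lambda>xs. 0)"
    by (simp add: fun_eq_iff)
  with cochain show ?thesis
    by (simp add: TQ_cocycles_def)
qed

lemma obstruction_class_independent:
  assumes s: "normalized_section p s" and t: "normalized_section p t"
  shows "TQ_class X op sN 3 (obstruction_cochain X op sG i \<phi> s)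
    = TQ_class X op sN 3 (obstruction_cochain X op sG i \<phi> t)"
proof -
  let ?\<theta> = "obstruction_cochain X op sG i \<phi>"
  \<comment> \<open>The cochain with \<open>\<theta>\<^sub>s - \<theta>\<^sub>t\<close> as its coboundary lifts \<open>t \<circ> \<phi> - s \<circ> \<phi>\<close>.\<close>
  have "p (t (\<phi> xs) - s (\<phi> xs)) = 0" for xs
    using s t by (simp add: p.diff normalized_section_def)
  then obtain \<eta> where \<eta>: "\<And>xs. i (\<eta> xs) = t (\<phi> xs) - s (\<phi> xs)"
    using lift_to_N[of "\<lambda>xs. t (\<phi> xs) - s (\<phi> xs)"] by blast
  have "(\<lambda>xs. i (\<eta> xs)) \<in> TQ_cochains X 2"
    unfolding \<eta> by (intro TQ_cochains_diff section_cochain s t)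
  then have cochain: "\<eta> \<in> TQ_cochains X 2"
    by (rule TQ_cochains_comp_cancel[OF _ inj i.zero])
  have "i (TQ_delta X op sN 2 \<eta> xs) = TQ_delta X op sG 2 (\<lambda>xs. i (\<eta> xs)) xs" for xs
    by (simp only: TQ_delta_hom[OF i.module_hom_axioms])
  also have "\<dots> xs = i (?\<theta> s xs - ?\<theta> t xs)" for xs
    by (simp add: \<eta> TQ_delta_diff[OF mod_G] i.diff i_obstruction s t)
  finally have "(\<lambda>xs. ?\<theta> s xs - ?\<theta> t xs) = TQ_delta X op sN 2 \<eta>"
    by (simp add: fun_eq_iff)
  with cochain have "(\<lambda>xs. ?\<theta> s xs - ?\<theta> t xs) \<in> TQ_coboundaries X op sN 3"
    by (simp add: TQ_coboundaries_def)
  then show ?thesis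
    by (simp add: TQ_class_eq_iff[OF mod_N] obstruction_cocycle s t)
qed

lemma cocycle_lift:
  assumes s: "normalized_section p s"
    and zero: "TQ_class X op sN 3 (obstruction_cochain X op sG i \<phi> s) = TQ_zero_class X op sN 3"
  shows "\<exists>\<psi>\<in>TQ_cocycles X op sG 2. \<forall>xs. p (\<psi> xs) = \<phi> xs"
proof -
  let ?\<theta> = "obstruction_cochain X op sG i \<phi> s"
  have "?\<theta> \<in> TQ_coboundaries X op sN 3"
    using zero
    by (simp add: TQ_zero_class_def TQ_class_eq_iff[OF mod_N] obstruction_cocycle[OF s]
        TQ_cocycles_zero[OF mod_N])
  then obtain \<eta> where \<eta>: "\<eta> \<in> TQ_cochains X 2" "?\<theta> = TQ_delta X op sN 2 \<eta>"
    by (auto simp: TQ_coboundaries_def)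
  let ?\<psi> = "\<lambda>xs. s (\<phi> xs) + i (\<eta> xs)"
  have "?\<psi> \<in> TQ_cochains X 2"
    using section_cochain[OF s] TQ_cochains_comp[where h = i, OF \<eta>(1) i.zero]
    by (simp add: TQ_cochains_2_iff)
  moreover have "TQ_delta X op sG 2 ?\<psi> = (\<lambda>xs. 0)"
    by (simp add: TQ_delta_add[OF mod_G] TQ_delta_hom[OF i.module_hom_axioms]
        \<eta>(2)[symmetric] i_obstruction[OF s])
  ultimately have "?\<psi> \<in> TQ_cocycles X op sG 2"
    by (simp add: TQ_cocycles_def)
  moreover have "p (?\<psi> xs) = \<phi> xs" for xs
    using s by (simp add: p.add normalized_section_def)
  ultimately show ?thesis by (intro bexI[of _ ?\<psi>]) blast+
qed

lemma extension:
  assumes "normalized_section p s"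
    and "TQ_class X op sN 3 (obstruction_cochain X op sG i \<phi> s) = TQ_zero_class X op sN 3"
  shows "\<exists>op'. quandle (UNIV \<times> X) op'
    \<and> quandle_hom (UNIV \<times> X) op' (UNIV \<times> X) (AE_op op sA \<phi>) (map_prod p id)"
proof -
  from cocycle_lift[OF assms] obtain \<psi>
    where "\<psi> \<in> TQ_cocycles X op sG 2" "\<And>xs. p (\<psi> xs) = \<phi> xs"
    by blast
  then show ?thesis
    using quandle_AE[OF quandle mod_G] quandle_hom_AE[OF quandle p.module_hom_axioms _ cocycle]
    by blast
qed

end

theorem theorem4p14:
  fixes X :: "'x set" and op :: "'x \<Rightarrow> 'x \<Rightarrow> 'x"
    and sN :: "laurent \<Rightarrow> 'n \<Rightarrow> 'n::ab_group_add"
    and sG :: "laurent \<Rightarrow> 'g \<Rightarrow> 'g::ab_group_add"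
    and sA :: "laurent \<Rightarrow> 'a \<Rightarrow> 'a::ab_group_add"
    and i :: "'n \<Rightarrow> 'g" and p :: "'g \<Rightarrow> 'a" and \<phi> :: "'x list \<Rightarrow> 'a"
  assumes "quandle X op"
    and "short_exact sN sG sA i p"
    and "\<phi> \<in> TQ_cocycles X op sA 2"
  shows "(\<forall>s. normalized_section p s \<longrightarrow>
            (\<exists>!\<theta>. is_obstruction_cochain X op sG i \<phi> s \<theta>)
            \<and> obstruction_cochain X op sG i \<phi> s \<in> TQ_cocycles X op sN 3
            \<and> TQ_class X op sN 3 (obstruction_cochain X op sG i \<phi> s) \<in> TQ_cohomology X op sN 3)
       \<and> (\<forall>s t. normalized_section p s \<longrightarrow> normalized_section p t \<longrightarrow>
            TQ_class X op sN 3 (obstruction_cochain X op sG i \<phi> s)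
            = TQ_class X op sN 3 (obstruction_cochain X op sG i \<phi> t))
       \<and> (\<forall>s. normalized_section p s \<longrightarrow>
            TQ_class X op sN 3 (obstruction_cochain X op sG i \<phi> s) = TQ_zero_class X op sN 3 \<longrightarrow>
            (\<exists>op'. quandle (UNIV \<times> X) op'
               \<and> quandle_hom (UNIV \<times> X) op' (UNIV \<times> X) (AE_op op sA \<phi>) (map_prod p id)))"
proof -
  interpret obstruction X op sN sG sA i p \<phi>
    using assms by (rule obstruction.intro)
  show ?thesis
    using ex1_obstruction obstruction_cocycle TQ_class_in_cohomology
      obstruction_class_independent extension
    by blast
qed

end
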